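(* A triple $(a, b, c)$ of positive integers is index-realizable if and only if there exists a bipartite graph $\Gamma$ with partitions $\eta$ and $\kappa$ such that: (1) $\Gamma$ has no isolated vertices; (2) $|\eta| = a$, $|\kappa| = b$, and $|E(\Gamma)| = c$; (3) $\mathrm{Aut}(\Gamma)$ acts transitively on $E(\Gamma)$.
   Context: A triple $(a,b,c)$ of positive integers is called index-realizable if there exists a group $G$ with finite index subgroups $H$ and $K$ such that $a = [G:H]$, $b = [G:K]$, and $c = [G : H\cap K]$. Graphs are simple (no multiple edges). A bipartite graph $\Gamma$ with partitions $\eta$ and $\kappa$ has vertex set the disjoint union of $\eta$ and $\kappa$, and its edge set $E(\Gamma)$ is identified with a subset of $\eta\times\kappa$. For such $\Gamma$, $\mathrm{Aut}(\Gamma)$ denotes the group of automorphisms of $\Gamma$ stabilizing $\eta$ and $\kappa$ set-wise. *)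

theory Defs
  imports "HOL-Algebra.Group_Action" "HOL-Library.Infinite_Typeclass"
begin

text \<open>
  HOL cannot quantify existentially over types, so the type from which the elements
  of the ambient group are drawn is a parameter. A finite type may be too small to carry
  the required group, so the notion is meant for infinite types; any group can be
  transported to one of these.
\<close>

definition index_realizable :: "'g itself \<Rightarrow> nat \<Rightarrow> nat \<Rightarrow> nat \<Rightarrow> bool" where
  "index_realizable _ a b c \<longleftrightarrow>
     (\<exists>(G :: 'g monoid) H K. group G \<and> subgroup H G \<and> subgroup K G \<and>
        finite (rcosets\<^bsub>G\<^esub> H) \<and> finite (rcosets\<^bsub>G\<^esub> K) \<and>
        a = card (rcosets\<^bsub>G\<^esub> H) \<and> b = card (rcosets\<^bsub>G\<^esub> K) \<and>
        c = card (rcosets\<^bsub>G\<^esub> (H \<inter> K)))"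

text \<open>
  The vertex set is the disjoint union of \<open>\<eta>\<close> and \<open>\<kappa>\<close>; an edge joining
  \<open>x \<in> \<eta>\<close> and \<open>y \<in> \<kappa>\<close> is represented by the pair \<open>(x, y)\<close>.
\<close>

locale bipartite_graph =
  fixes \<eta> \<kappa> :: "'v set" and E :: "('v \<times> 'v) set"
  assumes disjoint: "\<eta> \<inter> \<kappa> = {}"
    and edges: "E \<subseteq> \<eta> \<times> \<kappa>"

definition no_isolated_vertices :: "'v set \<Rightarrow> 'v set \<Rightarrow> ('v \<times> 'v) set \<Rightarrow> bool" where
  "no_isolated_vertices \<eta> \<kappa> E \<longleftrightarrow>
     (\<forall>x\<in>\<eta>. \<exists>y\<in>\<kappa>. (x, y) \<in> E) \<and> (\<forall>y\<in>\<kappa>. \<exists>x\<in>\<eta>. (x, y) \<in> E)"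

definition bip_Aut :: "'v set \<Rightarrow> 'v set \<Rightarrow> ('v \<times> 'v) set \<Rightarrow> ('v \<Rightarrow> 'v) monoid" where
  "bip_Aut \<eta> \<kappa> E = (BijGroup (\<eta> \<union> \<kappa>))
     \<lparr>carrier := {f \<in> Bij (\<eta> \<union> \<kappa>). f ` \<eta> = \<eta> \<and> f ` \<kappa> = \<kappa> \<and>
        (\<forall>x\<in>\<eta>. \<forall>y\<in>\<kappa>. (x, y) \<in> E \<longleftrightarrow> (f x, f y) \<in> E)}\<rparr>"

text \<open>
  The restriction to \<open>E\<close> is needed because library actions take values in
  \<^const>\<open>BijGroup\<close>, whose elements are extensional functions.
\<close>

definition edge_action :: "('v \<times> 'v) set \<Rightarrow> ('v \<Rightarrow> 'v) \<Rightarrow> 'v \<times> 'v \<Rightarrow> 'v \<times> 'v" where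
  "edge_action E f = restrict (map_prod f f) E"

end

theory Submission
  imports Defs "HOL-Algebra.Weak_Morphisms"
begin

text \<open>
  Subgroups of a group correspond to points in transitive actions, and their indices to
  orbit sizes; an edge is a pair of points, so its stabilizer is the intersection of the
  stabilizers of its two ends.

  Given an edge-transitive graph, take the automorphism group and let \<open>H\<close> and \<open>K\<close> be the
  stabilizers of the two ends of one edge. As every vertex lies on an edge, transitivity on
  edges gives transitivity on each part, so orbit-stabilizer yields the indices \<open>a\<close>, \<open>b\<close> and
  \<open>c\<close> (\<open>index_realizable_of_edge_transitive\<close>). The automorphism group is finite, hence has an
  isomorphic copy inside any infinite type (\<open>index_realizable_finite_group\<close>).

  Conversely, given \<open>H\<close> and \<open>K\<close>, take the right cosets of \<open>H\<close> and of \<open>K\<close> as vertices and join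
  two cosets when they meet. A nonempty intersection of \<open>H x\<close> and \<open>K y\<close> is a right coset of
  \<open>H \<inter> K\<close>, and each coset of \<open>H \<inter> K\<close> arises from exactly one such pair, so the edges are
  counted by the index of \<open>H \<inter> K\<close> (\<open>bij_betw_meeting_rcosets\<close>). Right multiplication by
  elements of the group preserves incidence and carries the pair \<open>(H x, K x)\<close> to any
  \<open>(H y, K y)\<close>, which is edge-transitivity (\<open>coset_graph_edge_transitive\<close>).
\<close>

section \<open>The automorphism group of a bipartite graph and its actions\<close>

lemma carrier_bip_Aut:
  "carrier (bip_Aut \<eta> \<kappa> E) = {f \<in> Bij (\<eta> \<union> \<kappa>). f ` \<eta> = \<eta> \<and> f ` \<kappa> = \<kappa> \<and>
     (\<forall>x\<in>\<eta>. \<forall>y\<in>\<kappa>. (x, y) \<in> E \<longleftrightarrow> (f x, f y) \<in> E)}"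
  by (simp add: bip_Aut_def)

lemma subgroup_bip_Aut: "subgroup (carrier (bip_Aut \<eta> \<kappa> E)) (BijGroup (\<eta> \<union> \<kappa>))"
proof
  let ?S = "\<eta> \<union> \<kappa>"
  show "carrier (bip_Aut \<eta> \<kappa> E) \<subseteq> carrier (BijGroup ?S)"
    by (auto simp: carrier_bip_Aut BijGroup_def)
  show "\<one>\<^bsub>BijGroup ?S\<^esub> \<in> carrier (bip_Aut \<eta> \<kappa> E)"
    by (auto simp: carrier_bip_Aut BijGroup_def id_Bij)
  fix f assume f: "f \<in> carrier (bip_Aut \<eta> \<kappa> E)"
  have fS: "f \<in> Bij ?S" and f\<eta>: "f ` \<eta> = \<eta>" and f\<kappa>: "f ` \<kappa> = \<kappa>"
    and fE: "\<And>x y. x \<in> \<eta> \<Longrightarrow> y \<in> \<kappa> \<Longrightarrow> (x, y) \<in> E \<longleftrightarrow> (f x, f y) \<in> E"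
    using f by (auto simp: carrier_bip_Aut)
  show "f \<otimes>\<^bsub>BijGroup ?S\<^esub> g \<in> carrier (bip_Aut \<eta> \<kappa> E)"
    if g: "g \<in> carrier (bip_Aut \<eta> \<kappa> E)" for g
  proof -
    have gS: "g \<in> Bij ?S" and g\<eta>: "g ` \<eta> = \<eta>" and g\<kappa>: "g ` \<kappa> = \<kappa>"
      and gE: "\<And>x y. x \<in> \<eta> \<Longrightarrow> y \<in> \<kappa> \<Longrightarrow> (x, y) \<in> E \<longleftrightarrow> (g x, g y) \<in> E"
      using g by (auto simp: carrier_bip_Aut)
    have "compose ?S f g ` \<eta> = f ` g ` \<eta>" "compose ?S f g ` \<kappa> = f ` g ` \<kappa>"
      by (force simp: compose_def)+
    moreover have "(x, y) \<in> E \<longleftrightarrow> (compose ?S f g x, compose ?S f g y) \<in> E"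
      if "x \<in> \<eta>" "y \<in> \<kappa>" for x y
    proof -
      have "g x \<in> \<eta>" "g y \<in> \<kappa>" using that g\<eta> g\<kappa> by auto
      then show ?thesis using that fE[of "g x" "g y"] gE[of x y] by (simp add: compose_def)
    qed
    ultimately show ?thesis
      using fS gS f\<eta> f\<kappa> g\<eta> g\<kappa> by (simp add: carrier_bip_Aut BijGroup_def compose_Bij)
  qed
  define h where "h = restrict (inv_into ?S f) ?S"
  have inj: "inj_on f ?S" using fS by (auto simp: Bij_def bij_betw_def)
  have hf: "h (f x) = x" if "x \<in> ?S" for x
    using that inj f\<eta> f\<kappa> by (auto simp: h_def)
  have "h ` f ` \<eta> = \<eta>" "h ` f ` \<kappa> = \<kappa>"
    using hf by (simp_all add: image_image)
  then have h\<eta>: "h ` \<eta> = \<eta>" and h\<kappa>: "h ` \<kappa> = \<kappa>"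
    by (simp_all add: f\<eta> f\<kappa>)
  have fh: "f (h x) = x" if "x \<in> ?S" for x
    using that f\<eta> f\<kappa> hf by (metis UnE UnI1 UnI2 imageE)
  have "(x, y) \<in> E \<longleftrightarrow> (h x, h y) \<in> E" if "x \<in> \<eta>" "y \<in> \<kappa>" for x y
  proof -
    have "h x \<in> \<eta>" "h y \<in> \<kappa>" using that h\<eta> h\<kappa> by auto
    then show ?thesis using that fE[of "h x" "h y"] fh by simp
  qed
  then show "inv\<^bsub>BijGroup ?S\<^esub> f \<in> carrier (bip_Aut \<eta> \<kappa> E)"
    using fS h\<eta> h\<kappa> restrict_inv_into_Bij[OF fS]
    unfolding inv_BijGroup[OF fS] h_def[symmetric] carrier_bip_Aut by simp
qed

lemma bip_Aut_eq: "bip_Aut \<eta> \<kappa> E = BijGroup (\<eta> \<union> \<kappa>) \<lparr>carrier := carrier (bip_Aut \<eta> \<kappa> E)\<rparr>"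
  by (simp add: bip_Aut_def)

lemma group_bip_Aut: "group (bip_Aut \<eta> \<kappa> E)"
  using subgroup.subgroup_is_group[OF subgroup_bip_Aut group_BijGroup]
  by (subst bip_Aut_eq)

lemma vertex_action: "group_action (bip_Aut \<eta> \<kappa> E) (\<eta> \<union> \<kappa>) (\<lambda>f. f)"
proof -
  have "(\<lambda>f. f) \<in> hom (bip_Aut \<eta> \<kappa> E) (BijGroup (\<eta> \<union> \<kappa>))"
    by (auto simp: hom_def bip_Aut_def BijGroup_def)
  then show ?thesis
    by (simp add: group_action_def group_hom_def group_hom_axioms_def group_bip_Aut group_BijGroup)
qed

lemma mult_bip_Aut:
  assumes "f \<in> carrier (bip_Aut \<eta> \<kappa> E)" "g \<in> carrier (bip_Aut \<eta> \<kappa> E)"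
  shows "f \<otimes>\<^bsub>bip_Aut \<eta> \<kappa> E\<^esub> g = compose (\<eta> \<union> \<kappa>) f g"
  using assms by (simp add: bip_Aut_def BijGroup_def)

lemma finite_bip_Aut:
  assumes "finite \<eta>" "finite \<kappa>"
  shows "finite (carrier (bip_Aut \<eta> \<kappa> E))"
proof (rule finite_subset)
  show "carrier (bip_Aut \<eta> \<kappa> E) \<subseteq> (\<eta> \<union> \<kappa>) \<rightarrow>\<^sub>E (\<eta> \<union> \<kappa>)"
    by (auto simp: carrier_bip_Aut PiE_def Bij_imp_extensional dest: Bij_imp_funcset)
  show "finite ((\<eta> \<union> \<kappa>) \<rightarrow>\<^sub>E (\<eta> \<union> \<kappa>))"
    using assms by (simp add: finite_PiE)
qed

context bipartite_graph
begin

lemma edge_action: "group_action (bip_Aut \<eta> \<kappa> E) E (edge_action E)"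
proof -
  let ?A = "bip_Aut \<eta> \<kappa> E"
  have mem: "edge_action E f \<in> Bij E" if f: "f \<in> carrier ?A" for f
  proof -
    have inj: "inj_on f (\<eta> \<union> \<kappa>)" and f\<eta>: "f ` \<eta> = \<eta>" and f\<kappa>: "f ` \<kappa> = \<kappa>"
      and fE: "\<And>x y. x \<in> \<eta> \<Longrightarrow> y \<in> \<kappa> \<Longrightarrow> (x, y) \<in> E \<longleftrightarrow> (f x, f y) \<in> E"
      using f by (auto simp: carrier_bip_Aut Bij_def bij_betw_def)
    have "inj_on (map_prod f f) E"
      by (rule inj_on_subset[OF map_prod_inj_on[OF inj inj]]) (use edges in auto)
    moreover have "map_prod f f ` E = E"
    proof
      show "map_prod f f ` E \<subseteq> E" using fE edges by auto
      show "E \<subseteq> map_prod f f ` E"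
      proof
        \<comment> \<open>An automorphism also reflects adjacency, so the preimage of an edge is an edge.\<close>
        fix e assume e: "e \<in> E"
        then obtain x y where xy: "e = (x, y)" "x \<in> \<eta>" "y \<in> \<kappa>" using edges by auto
        then obtain x' y' where xy': "x = f x'" "y = f y'" "x' \<in> \<eta>" "y' \<in> \<kappa>"
          using f\<eta> f\<kappa> by (metis imageE)
        then have "(x', y') \<in> E" using e xy fE by simp
        then show "e \<in> map_prod f f ` E" using xy xy' by force
      qed
    qed
    ultimately show ?thesis
      by (simp add: edge_action_def Bij_def bij_betw_def inj_on_restrict_eq)
  qed
  moreover have "edge_action E (f \<otimes>\<^bsub>?A\<^esub> g) = compose E (edge_action E f) (edge_action E g)"
    if f: "f \<in> carrier ?A" and g: "g \<in> carrier ?A" for f g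
  proof
    fix e
    show "edge_action E (f \<otimes>\<^bsub>?A\<^esub> g) e = compose E (edge_action E f) (edge_action E g) e"
    proof (cases "e \<in> E")
      case True
      then have "edge_action E g e \<in> E"
        using mem[OF g] Bij_imp_funcset by blast
      then show ?thesis
        using True edges by (auto simp: edge_action_def mult_bip_Aut[OF f g] compose_def)
    qed (simp add: edge_action_def compose_def)
  qed
  ultimately have "edge_action E \<in> hom ?A (BijGroup E)"
    by (simp add: hom_def BijGroup_def)
  then show ?thesis
    by (simp add: group_action_def group_hom_def group_hom_axioms_def group_bip_Aut group_BijGroup)
qed

text \<open>
  Automorphisms are extensional functions on the vertices; this turns a pair of permutations,
  one of each part, into one.
\<close>

lemma glued_bijection_in_bip_Aut:
  assumes p: "bij_betw p \<eta> \<eta>" and q: "bij_betw q \<kappa> \<kappa>"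
    and pq: "\<And>x y. x \<in> \<eta> \<Longrightarrow> y \<in> \<kappa> \<Longrightarrow> (x, y) \<in> E \<longleftrightarrow> (p x, q y) \<in> E"
  shows "restrict (\<lambda>v. if v \<in> \<eta> then p v else q v) (\<eta> \<union> \<kappa>) \<in> carrier (bip_Aut \<eta> \<kappa> E)"
    (is "?f \<in> _")
proof -
  have f: "?f x = p x" "?f y = q y" if "x \<in> \<eta>" "y \<in> \<kappa>" for x y
    using that disjoint by auto
  have f\<eta>: "bij_betw ?f \<eta> \<eta>"
    using p by (rule bij_betw_cong[THEN iffD1, rotated]) simp
  have f\<kappa>: "bij_betw ?f \<kappa> \<kappa>"
    using q by (rule bij_betw_cong[THEN iffD1, rotated]) (use disjoint in auto)
  have "bij_betw ?f (\<eta> \<union> \<kappa>) (\<eta> \<union> \<kappa>)"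
    using f\<eta> f\<kappa> disjoint by (rule bij_betw_combine)
  then have "?f \<in> Bij (\<eta> \<union> \<kappa>)"
    by (simp add: Bij_def)
  moreover have "(x, y) \<in> E \<longleftrightarrow> (?f x, ?f y) \<in> E" if "x \<in> \<eta>" "y \<in> \<kappa>" for x y
    using pq[OF that] f[OF that] by simp
  ultimately show ?thesis
    using f\<eta>[THEN bij_betw_imp_surj_on] f\<kappa>[THEN bij_betw_imp_surj_on]
    unfolding carrier_bip_Aut by blast
qed

end

section \<open>From edge-transitive graphs to subgroups\<close>

lemma stabilizer_index:
  assumes "group_action G X \<phi>" "x \<in> X" "orbit G \<phi> x = Y"
  shows "card (rcosets\<^bsub>G\<^esub> (stabilizer G \<phi> x)) = card Y"
  using group_action.orbit_stab_fun_is_bij[OF assms(1,2)] bij_betw_same_card assms(3) by blast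

text \<open>
  Isomorphisms preserve indices; a bijection between cosets gives both that they are
  finite in number and what this number is.
\<close>

lemma (in group_hom) rcosets_image:
  assumes inj: "inj_on h (carrier G)" and surj: "h ` carrier G = carrier H"
    and S: "S \<subseteq> carrier G"
  shows "bij_betw ((`) h) (rcosets\<^bsub>G\<^esub> S) (rcosets\<^bsub>H\<^esub> (h ` S))"
proof -
  have "rcosets\<^bsub>G\<^esub> S \<subseteq> Pow (carrier G)"
    using S G.rcosets_subset_PowG by (auto simp: RCOSETS_def r_coset_def)
  then have "inj_on ((`) h) (rcosets\<^bsub>G\<^esub> S)"
    using inj by (meson inj_on_image_Pow inj_on_subset)
  moreover have "h ` (S #>\<^bsub>G\<^esub> a) = h ` S #>\<^bsub>H\<^esub> h a" if "a \<in> carrier G" for a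
    using that S by (force simp: r_coset_def)
  then have "(`) h ` (rcosets\<^bsub>G\<^esub> S) = rcosets\<^bsub>H\<^esub> (h ` S)"
    unfolding RCOSETS_def surj[symmetric] by auto
  ultimately show ?thesis by (simp add: bij_betw_def)
qed

text \<open>
  A finite group of any type injects into an infinite type, and the group structure can be
  carried along the injection. This removes the dependence of index-realizability on the type
  of the group elements.
\<close>

lemma index_realizable_finite_group:
  fixes G :: "('b, 'm) monoid_scheme"
  assumes G: "group G" and fin: "finite (carrier G)" and H: "subgroup H G" and K: "subgroup K G"
  shows "index_realizable TYPE('g::infinite)
    (card (rcosets\<^bsub>G\<^esub> H)) (card (rcosets\<^bsub>G\<^esub> K)) (card (rcosets\<^bsub>G\<^esub> (H \<inter> K)))"
proof -
  interpret G: group G by (fact G)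
  obtain h :: "'b \<Rightarrow> 'g" where h: "inj_on h (carrier G)"
    using arb_inj_on_finite_infinite[OF fin] by blast
  let ?I = "image_group h G"
  have iso: "h \<in> iso G ?I"
    using inj_imp_image_group_iso[OF h] .
  have I: "group ?I"
    using G.inj_imp_image_group_is_group[OF h] .
  interpret h: group_hom G ?I h
    using G I iso by (simp add: group_hom_def group_hom_axioms_def iso_def)
  have index: "card (rcosets\<^bsub>?I\<^esub> (h ` S)) = card (rcosets\<^bsub>G\<^esub> S)"
      "finite (rcosets\<^bsub>?I\<^esub> (h ` S))" if "subgroup S G" for S
  proof -
    have bij: "bij_betw ((`) h) (rcosets\<^bsub>G\<^esub> S) (rcosets\<^bsub>?I\<^esub> (h ` S))"
      using h.rcosets_image[OF h _ subgroup.subset[OF that]] by (simp add: image_group_carrier)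
    then show "card (rcosets\<^bsub>?I\<^esub> (h ` S)) = card (rcosets\<^bsub>G\<^esub> S)"
      by (simp add: bij_betw_same_card)
    have "finite (rcosets\<^bsub>G\<^esub> S)" using fin by (simp add: RCOSETS_def)
    then show "finite (rcosets\<^bsub>?I\<^esub> (h ` S))"
      using bij bij_betw_finite by blast
  qed
  have "h ` (H \<inter> K) = h ` H \<inter> h ` K"
    using h H K by (meson inj_on_image_Int subgroup.subset)
  then show ?thesis
    unfolding index_realizable_def
    using I h.subgroup_img_is_subgroup H K index G.subgroups_Inter_pair[OF H K]
    by metis
qed

text \<open>
  The subgroups are the stabilizers of the two ends of a fixed edge. Without isolated
  vertices, moving that edge onto all others moves its ends onto all vertices.
\<close>

lemma (in bipartite_graph) index_realizable_of_edge_transitive: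
  assumes noiso: "no_isolated_vertices \<eta> \<kappa> E" and fin: "finite \<eta>" "finite \<kappa>"
    and nonempty: "E \<noteq> {}"
    and trans: "transitive_action (bip_Aut \<eta> \<kappa> E) E (edge_action E)"
  shows "index_realizable TYPE('g::infinite) (card \<eta>) (card \<kappa>) (card E)"
proof -
  let ?A = "bip_Aut \<eta> \<kappa> E"
  interpret V: group_action ?A "\<eta> \<union> \<kappa>" "\<lambda>f. f" by (rule vertex_action)
  interpret T: transitive_action ?A E "edge_action E" by (fact trans)
  obtain x y where xy: "(x, y) \<in> E" using nonempty by auto
  then have x: "x \<in> \<eta>" and y: "y \<in> \<kappa>" using edges by auto
  let ?H = "stabilizer ?A (\<lambda>f. f) x" and ?K = "stabilizer ?A (\<lambda>f. f) y"
  have move: "\<exists>f \<in> carrier ?A. f x = x' \<and> f y = y'" if "(x', y') \<in> E" for x' y'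
    using T.unique_orbit[OF xy that] xy by (auto simp: edge_action_def)
  have "orbit ?A (\<lambda>f. f) x = \<eta>"
  proof
    show "orbit ?A (\<lambda>f. f) x \<subseteq> \<eta>" using x by (auto simp: orbit_def carrier_bip_Aut)
    show "\<eta> \<subseteq> orbit ?A (\<lambda>f. f) x"
      using noiso move by (fastforce simp: orbit_def no_isolated_vertices_def)
  qed
  then have "card (rcosets\<^bsub>?A\<^esub> ?H) = card \<eta>"
    using x by (simp add: stabilizer_index[OF vertex_action])
  moreover have "orbit ?A (\<lambda>f. f) y = \<kappa>"
  proof
    show "orbit ?A (\<lambda>f. f) y \<subseteq> \<kappa>" using y by (auto simp: orbit_def carrier_bip_Aut)
    show "\<kappa> \<subseteq> orbit ?A (\<lambda>f. f) y"
      using noiso move by (fastforce simp: orbit_def no_isolated_vertices_def)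
  qed
  then have "card (rcosets\<^bsub>?A\<^esub> ?K) = card \<kappa>"
    using y by (simp add: stabilizer_index[OF vertex_action])
  moreover have "orbit ?A (edge_action E) (x, y) = E"
  proof
    show "orbit ?A (edge_action E) (x, y) \<subseteq> E"
      using T.element_image[OF _ xy] unfolding orbit_def by blast
    show "E \<subseteq> orbit ?A (edge_action E) (x, y)"
      using T.unique_orbit[OF xy] unfolding orbit_def by blast
  qed
  then have "card (rcosets\<^bsub>?A\<^esub> (stabilizer ?A (edge_action E) (x, y))) = card E"
    by (rule stabilizer_index[OF edge_action xy])
  moreover have "stabilizer ?A (edge_action E) (x, y) = ?H \<inter> ?K"
    using xy by (auto simp: stabilizer_def edge_action_def)
  ultimately show ?thesis
    using index_realizable_finite_group[OF group_bip_Aut finite_bip_Aut[OF fin]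
        V.stabilizer_subgroup V.stabilizer_subgroup, of x y] x y
    by simp
qed

section \<open>From subgroups to edge-transitive graphs\<close>

context group
begin

lemma r_coset_inter:
  assumes "A \<subseteq> carrier G" "B \<subseteq> carrier G" "g \<in> carrier G"
  shows "(A #> g) \<inter> (B #> g) = (A \<inter> B) #> g"
proof -
  have "S #> g = (\<lambda>s. s \<otimes> g) ` S" for S
    by (auto simp: r_coset_def)
  then show ?thesis
    using inj_on_image_Int[OF inj_on_multc[OF assms(3)] assms(1,2)] by simp
qed

lemma r_coset_eq_of_mem:
  assumes "subgroup H G" "C \<in> rcosets H" "x \<in> C"
  shows "x \<in> carrier G \<and> C = H #> x"
  using assms subgroup.rcosets_carrier[OF assms(1) is_group assms(2)]
  by (auto simp: RCOSETS_def dest: repr_independence)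

lemma rcosets_mult_bij:
  assumes H: "subgroup H G" and g: "g \<in> carrier G"
  shows "bij_betw (\<lambda>C. C #> g) (rcosets H) (rcosets H)"
proof (rule bij_betwI)
  have sub: "C \<subseteq> carrier G" if "C \<in> rcosets H" for C
    using subgroup.rcosets_carrier[OF H is_group that] .
  have map: "C #> k \<in> rcosets H" if "C \<in> rcosets H" "k \<in> carrier G" for C k
    using that subgroup.subset[OF H] by (auto simp: RCOSETS_def coset_mult_assoc)
  show "(\<lambda>C. C #> g) \<in> rcosets H \<rightarrow> rcosets H"
    "(\<lambda>C. C #> inv g) \<in> rcosets H \<rightarrow> rcosets H" using map g by auto
  show "C #> g #> inv g = C" "C #> inv g #> g = C" if "C \<in> rcosets H" for C
    using that sub g by (simp_all add: coset_mult_assoc)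
qed

text \<open>
  If \<open>x\<close> lies in both \<open>C\<close> and \<open>D\<close>, then \<open>C = H x\<close>, \<open>D = K x\<close> and
  \<open>C \<inter> D = (H \<inter> K) x\<close>; so the intersection determines the pair, and every coset of
  \<open>H \<inter> K\<close> occurs.
\<close>

lemma bij_betw_meeting_rcosets:
  assumes H: "subgroup H G" and K: "subgroup K G"
  shows "bij_betw (\<lambda>(C, D). C \<inter> D)
    {(C, D). C \<in> rcosets H \<and> D \<in> rcosets K \<and> C \<inter> D \<noteq> {}} (rcosets (H \<inter> K))"
    (is "bij_betw _ ?M _")
proof -
  have rep: "\<exists>x\<in>carrier G. C = H #> x \<and> D = K #> x" if "(C, D) \<in> ?M" for C D
    using that r_coset_eq_of_mem[OF H] r_coset_eq_of_mem[OF K] by blast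
  have meet: "(H #> x) \<inter> (K #> x) = (H \<inter> K) #> x" if "x \<in> carrier G" for x
    using that H K by (simp add: r_coset_inter subgroup.subset)
  have "inj_on (\<lambda>(C, D). C \<inter> D) ?M"
  proof (rule inj_onI, clarify)
    fix C D C' D' x
    assume "C \<in> rcosets H" "D \<in> rcosets K" "C' \<in> rcosets H" "D' \<in> rcosets K"
      "C \<inter> D = C' \<inter> D'" "C \<inter> D \<noteq> {}"
    moreover from this obtain z where "z \<in> C" "z \<in> D" "z \<in> C'" "z \<in> D'" by blast
    ultimately show "C = C' \<and> D = D'"
      using r_coset_eq_of_mem[OF H] r_coset_eq_of_mem[OF K] by metis
  qed
  moreover have "(\<lambda>(C, D). C \<inter> D) ` ?M = rcosets (H \<inter> K)"
  proof
    show "(\<lambda>(C, D). C \<inter> D) ` ?M \<subseteq> rcosets (H \<inter> K)"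
    proof (rule image_subsetI, rule prod.exhaust)
      fix e C D assume "e \<in> ?M" "e = (C, D)"
      then obtain x where "x \<in> carrier G" "C = H #> x" "D = K #> x" using rep by blast
      then show "(case e of (C, D) \<Rightarrow> C \<inter> D) \<in> rcosets (H \<inter> K)"
        using meet \<open>e = (C, D)\<close> by (auto simp: RCOSETS_def)
    qed
    show "rcosets (H \<inter> K) \<subseteq> (\<lambda>(C, D). C \<inter> D) ` ?M"
    proof
      fix R assume "R \<in> rcosets (H \<inter> K)"
      then obtain x where x: "x \<in> carrier G" "R = (H \<inter> K) #> x" by (auto simp: RCOSETS_def)
      have "x \<in> (H #> x) \<inter> (K #> x)"
        using x H K rcos_self by blast
      then have "(H #> x, K #> x) \<in> ?M"
        using x H K by (auto simp: rcosetsI subgroup.subset)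
      then show "R \<in> (\<lambda>(C, D). C \<inter> D) ` ?M"
        by (rule rev_image_eqI) (simp add: x meet)
    qed
  qed
  ultimately show ?thesis by (simp add: bij_betw_def)
qed

text \<open>
  The incidence graph of cosets. The injections \<open>u\<close> and \<open>w\<close> name the vertices: one set may
  be a coset of both \<open>H\<close> and \<open>K\<close>, as when \<open>H = K\<close>, and its two occurrences have to be
  different vertices. Transitivity only asks for some automorphism between any two edges, so
  right multiplication by \<open>g\<close> serves directly, although it composes in the opposite order.
\<close>

theorem coset_graph_edge_transitive:
  fixes u w :: "'a set \<Rightarrow> 'v"
  assumes H: "subgroup H G" and K: "subgroup K G"
    and u: "inj_on u (rcosets H)" and w: "inj_on w (rcosets K)"
    and disj: "u ` (rcosets H) \<inter> w ` (rcosets K) = {}"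
  defines "\<eta> \<equiv> u ` (rcosets H)" and "\<kappa> \<equiv> w ` (rcosets K)"
    and "E \<equiv> map_prod u w ` {(C, D). C \<in> rcosets H \<and> D \<in> rcosets K \<and> C \<inter> D \<noteq> {}}"
  shows "bipartite_graph \<eta> \<kappa> E" "no_isolated_vertices \<eta> \<kappa> E"
    "card \<eta> = card (rcosets H)" "card \<kappa> = card (rcosets K)"
    "card E = card (rcosets (H \<inter> K))"
    "transitive_action (bip_Aut \<eta> \<kappa> E) E (edge_action E)"
proof -
  let ?M = "{(C, D). C \<in> rcosets H \<and> D \<in> rcosets K \<and> C \<inter> D \<noteq> {}}"
  show graph: "bipartite_graph \<eta> \<kappa> E"
    using disj by unfold_locales (auto simp: \<eta>_def \<kappa>_def E_def)
  then interpret bipartite_graph \<eta> \<kappa> E .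
  have adj: "(u C, w D) \<in> E \<longleftrightarrow> C \<inter> D \<noteq> {}" if "C \<in> rcosets H" "D \<in> rcosets K" for C D
    using that u w by (auto simp: E_def inj_on_eq_iff)
  have meet: "\<exists>C\<in>rcosets S. C \<inter> D \<noteq> {}"
    if S: "subgroup S G" and T: "subgroup T G" and D: "D \<in> rcosets T" for S T D
  proof -
    obtain x where x: "x \<in> carrier G" "D = T #> x" using D by (auto simp: RCOSETS_def)
    then have "x \<in> (S #> x) \<inter> D" using S T rcos_self by blast
    then show ?thesis
      using x rcosetsI[OF subgroup.subset[OF S], of x] by blast
  qed
  show "no_isolated_vertices \<eta> \<kappa> E"
    unfolding no_isolated_vertices_def \<eta>_def \<kappa>_def
    using adj meet[OF H K] meet[OF K H] by (fastforce simp: Int_commute)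
  show "card \<eta> = card (rcosets H)" "card \<kappa> = card (rcosets K)"
    using u w by (simp_all add: \<eta>_def \<kappa>_def card_image)
  have "inj_on (map_prod u w) ?M"
    using map_prod_inj_on[OF u w] by (rule inj_on_subset) auto
  then show "card E = card (rcosets (H \<inter> K))"
    using bij_betw_same_card[OF bij_betw_meeting_rcosets[OF H K]] by (simp add: E_def card_image)
  \<comment> \<open>Right multiplication by \<open>g\<close>, transported along \<open>u\<close> and \<open>w\<close>, is an automorphism.\<close>
  have aut: "\<exists>f \<in> carrier (bip_Aut \<eta> \<kappa> E).
      (\<forall>C\<in>rcosets H. f (u C) = u (C #> g)) \<and> (\<forall>D\<in>rcosets K. f (w D) = w (D #> g))"
    if g: "g \<in> carrier G" for g
  proof -
    define p where "p = u \<circ> (\<lambda>C. C #> g) \<circ> inv_into (rcosets H) u"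
    define q where "q = w \<circ> (\<lambda>D. D #> g) \<circ> inv_into (rcosets K) w"
    have pu: "p (u C) = u (C #> g)" if "C \<in> rcosets H" for C
      using that u by (simp add: p_def)
    have qw: "q (w D) = w (D #> g)" if "D \<in> rcosets K" for D
      using that w by (simp add: q_def)
    have transport: "bij_betw (i \<circ> s \<circ> inv_into X i) (i ` X) (i ` X)"
      if "inj_on i X" "bij_betw s X X" for i :: "'a set \<Rightarrow> 'v" and s X
      using that inj_on_imp_bij_betw bij_betw_inv_into bij_betw_trans by metis
    have "bij_betw p \<eta> \<eta>" "bij_betw q \<kappa> \<kappa>"
      unfolding p_def q_def \<eta>_def \<kappa>_def
      using transport[OF u rcosets_mult_bij[OF H g]] transport[OF w rcosets_mult_bij[OF K g]] by auto
    moreover have "(x, y) \<in> E \<longleftrightarrow> (p x, q y) \<in> E" if xy: "x \<in> \<eta>" "y \<in> \<kappa>" for x y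
    proof -
      obtain C D where CD: "x = u C" "y = w D" "C \<in> rcosets H" "D \<in> rcosets K"
        using xy by (auto simp: \<eta>_def \<kappa>_def)
      have "C \<subseteq> carrier G" "D \<subseteq> carrier G"
        using CD subgroup.rcosets_carrier[OF _ is_group] H K by auto
      then have "(C #> g) \<inter> (D #> g) = {} \<longleftrightarrow> C \<inter> D = {}"
        using g by (simp add: r_coset_inter) (auto simp: r_coset_def)
      moreover have "C #> g \<in> rcosets H" "D #> g \<in> rcosets K"
        using CD rcosets_mult_bij[OF _ g] H K bij_betwE by blast+
      ultimately show ?thesis
        using CD pu qw adj by simp
    qed
    ultimately have "restrict (\<lambda>v. if v \<in> \<eta> then p v else q v) (\<eta> \<union> \<kappa>) \<in> carrier (bip_Aut \<eta> \<kappa> E)"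
      by (rule glued_bijection_in_bip_Aut)
    moreover have "w D \<notin> \<eta>" if "D \<in> rcosets K" for D
      using that disj by (auto simp: \<eta>_def)
    ultimately show ?thesis
      using pu qw by (intro bexI) (auto simp: \<eta>_def \<kappa>_def)
  qed
  have "\<exists>f \<in> carrier (bip_Aut \<eta> \<kappa> E). edge_action E f e = e'" if e: "e \<in> E" and e': "e' \<in> E" for e e'
  proof -
    have rep: "\<exists>x\<in>carrier G. d = (u (H #> x), w (K #> x))" if "d \<in> E" for d
      using that r_coset_eq_of_mem[OF H] r_coset_eq_of_mem[OF K] by (fastforce simp: E_def)
    obtain x y where x: "x \<in> carrier G" "e = (u (H #> x), w (K #> x))"
      and y: "y \<in> carrier G" "e' = (u (H #> y), w (K #> y))"
      using rep e e' by blast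
    \<comment> \<open>Right multiplication by this element takes \<open>S x\<close> to \<open>S y\<close> for both subgroups at once.\<close>
    let ?g = "inv x \<otimes> y"
    obtain f where f: "f \<in> carrier (bip_Aut \<eta> \<kappa> E)"
      "\<forall>C\<in>rcosets H. f (u C) = u (C #> ?g)" "\<forall>D\<in>rcosets K. f (w D) = w (D #> ?g)"
      using aut[of ?g] x y by auto
    have "S #> x #> ?g = S #> y" if "subgroup S G" for S
      using that x y by (simp add: coset_mult_assoc subgroup.subset m_assoc[symmetric])
    then have "edge_action E f e = e'"
      using f x y e H K by (simp add: edge_action_def rcosetsI subgroup.subset)
    then show ?thesis using f by blast
  qed
  then show "transitive_action (bip_Aut \<eta> \<kappa> E) E (edge_action E)"
    using edge_action by (simp add: transitive_action_def transitive_action_axioms_def)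
qed

end

section \<open>The characterization of index-realizable triples\<close>

theorem theorem3p4:
  fixes a b c :: nat
  assumes "0 < a" and "0 < b" and "0 < c"
  shows "index_realizable TYPE('g::infinite) a b c \<longleftrightarrow>
    (\<exists>(\<eta> :: 'v::infinite set) \<kappa> E.
       bipartite_graph \<eta> \<kappa> E \<and>
       no_isolated_vertices \<eta> \<kappa> E \<and>
       card \<eta> = a \<and> card \<kappa> = b \<and> card E = c \<and>
       transitive_action (bip_Aut \<eta> \<kappa> E) E (edge_action E))"
proof
  assume "index_realizable TYPE('g) a b c"
  then obtain G :: "'g monoid" and H K where G: "group G" "subgroup H G" "subgroup K G"
    and fin: "finite (rcosets\<^bsub>G\<^esub> H)" "finite (rcosets\<^bsub>G\<^esub> K)"
    and abc: "a = card (rcosets\<^bsub>G\<^esub> H)" "b = card (rcosets\<^bsub>G\<^esub> K)" "c = card (rcosets\<^bsub>G\<^esub> (H \<inter> K))"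
    by (auto simp: index_realizable_def)
  \<comment> \<open>A single injection of the disjoint sum keeps the two parts of the graph disjoint.\<close>
  have "finite ((rcosets\<^bsub>G\<^esub> H) <+> (rcosets\<^bsub>G\<^esub> K))" using fin by simp
  then obtain \<psi> :: "'g set + 'g set \<Rightarrow> 'v" where \<psi>: "inj_on \<psi> ((rcosets\<^bsub>G\<^esub> H) <+> (rcosets\<^bsub>G\<^esub> K))"
    using arb_inj_on_finite_infinite by blast
  have u: "inj_on (\<psi> \<circ> Inl) (rcosets\<^bsub>G\<^esub> H)" and w: "inj_on (\<psi> \<circ> Inr) (rcosets\<^bsub>G\<^esub> K)"
    using \<psi> by (auto simp: inj_on_def Plus_def)
  have "(\<psi> \<circ> Inl) ` (rcosets\<^bsub>G\<^esub> H) \<inter> (\<psi> \<circ> Inr) ` (rcosets\<^bsub>G\<^esub> K) = {}"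
    using \<psi> by (auto simp: inj_on_def Plus_def)
  from group.coset_graph_edge_transitive[OF G u w this] abc
  show "\<exists>(\<eta> :: 'v set) \<kappa> E.
       bipartite_graph \<eta> \<kappa> E \<and>
       no_isolated_vertices \<eta> \<kappa> E \<and>
       card \<eta> = a \<and> card \<kappa> = b \<and> card E = c \<and>
       transitive_action (bip_Aut \<eta> \<kappa> E) E (edge_action E)"
    by blast
next
  assume "\<exists>(\<eta> :: 'v set) \<kappa> E.
       bipartite_graph \<eta> \<kappa> E \<and>
       no_isolated_vertices \<eta> \<kappa> E \<and>
       card \<eta> = a \<and> card \<kappa> = b \<and> card E = c \<and>
       transitive_action (bip_Aut \<eta> \<kappa> E) E (edge_action E)"
  then obtain \<eta> \<kappa> :: "'v set" and E where "bipartite_graph \<eta> \<kappa> E" "no_isolated_vertices \<eta> \<kappa> E"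
    and card: "card \<eta> = a" "card \<kappa> = b" "card E = c"
    and "transitive_action (bip_Aut \<eta> \<kappa> E) E (edge_action E)"
    by blast
  moreover have "finite \<eta>" "finite \<kappa>" "E \<noteq> {}"
    using card assms card_gt_0_iff by force+
  ultimately show "index_realizable TYPE('g) a b c"
    using bipartite_graph.index_realizable_of_edge_transitive by blast
qed

end
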